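(* Let $\mathcal{A}$ be a unital $C^*$-algebra, let $\mathcal{F}\subseteq\mathcal{A}$ be an ideal of finite type elements, and let $a\in\mathcal{A}$. Then the following holds. 1) If $a$ is an upper semi-Fredholm element and $\tilde p$ is a projection in $\mathcal{A}$ such that $a\tilde p=0$, then $\tilde p\in\mathcal{F}$. In particular, if $p,q$ are projections in $\mathcal{A}$ such that $a$ is invertible up to $(p,q)$ and $(1-q)a(1-p)=a$, then $a$ is an upper semi-Fredholm element if and only if $p\in\mathcal{F}$. 2) If $a$ is a lower semi-Fredholm element and $\tilde q$ is a projection in $\mathcal{A}$ such that $\tilde q a=0$, then $\tilde q\in\mathcal{F}$. In particular, if $p,q$ are projections in $\mathcal{A}$ such that $a$ is invertible up to $(p,q)$ and $(1-q)a(1-p)=a$, then $a$ is a lower semi-Fredholm element if and only if $q\in\mathcal{F}$.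
   Context: Ideal of finite type elements: a subalgebra $\mathcal{F}\subseteq\mathcal{A}$ such that (i) $\mathcal{F}$ is a selfadjoint ideal: $ab,ba\in\mathcal{F}$ for all $a\in\mathcal{A}$, $b\in\mathcal{F}$, and $a\in\mathcal{F}$ implies $a^*\in\mathcal{F}$; (ii) there is an approximate unit $(p_\alpha)$ (in the norm topology) for $\mathcal{F}$ consisting of projections; (iii) if $p,q\in\mathcal{F}$ are projections, then there exists $v\in\mathcal{A}$ such that $vv^*=q$ and $v^*v\perp p$, i.e. $v^*v+p$ is a projection. For $a\in\mathcal{A}$ and projections $p,q\in\mathcal{A}$, $a$ is invertible up to the pair $(p,q)$ if, with $a'=(1-q)a(1-p)$, there is $b\in\mathcal{A}$ with $b=(1-p)b(1-q)$, $a'b=1-q$, $ba'=1-p$. $a$ is an upper (resp. lower) semi-Fredholm element with respect to $\mathcal{F}$ if $a$ is invertible up to some pair $(p,q)$ of projections in $\mathcal{A}$ with $p\in\mathcal{F}$ (resp. $q\in\mathcal{F}$). *)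

theory Defs
  imports "HOL-Analysis.Analysis"
begin

text \<open>Unital (complex) C*-algebras. The unit is required through \<^class>\<open>monoid_mult\<close> rather than
  \<^class>\<open>real_normed_algebra_1\<close>, so the zero algebra is not excluded; in a nonzero algebra
  \<open>norm 1 = 1\<close> follows from the C*-identity.\<close>

class unital_cstar_algebra = real_normed_algebra + banach + monoid_mult +
  fixes scaleC :: "complex \<Rightarrow> 'a \<Rightarrow> 'a"
    and star :: "'a \<Rightarrow> 'a"
  assumes scaleC_add_right: "scaleC c (x + y) = scaleC c x + scaleC c y"
    and scaleC_add_left: "scaleC (c + d) x = scaleC c x + scaleC d x"
    and scaleC_scaleC: "scaleC c (scaleC d x) = scaleC (c * d) x"
    and scaleC_of_real: "scaleC (complex_of_real r) x = scaleR r x"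
    and mult_scaleC_left: "scaleC c x * y = scaleC c (x * y)"
    and mult_scaleC_right: "x * scaleC c y = scaleC c (x * y)"
    and norm_scaleC: "norm (scaleC c x) = cmod c * norm x"
    and star_star: "star (star x) = x"
    and star_add: "star (x + y) = star x + star y"
    and star_scaleC: "star (scaleC c x) = scaleC (cnj c) (star x)"
    and star_mult: "star (x * y) = star y * star x"
    and cstar_identity: "norm (star x * x) = (norm x)\<^sup>2"

definition is_projection :: "'a::unital_cstar_algebra \<Rightarrow> bool" where
  "is_projection p \<longleftrightarrow> p * p = p \<and> star p = p"

definition subalgebra :: "'a::unital_cstar_algebra set \<Rightarrow> bool" where
  "subalgebra F \<longleftrightarrow> 0 \<in> F \<and> (\<forall>x\<in>F. \<forall>y\<in>F. x + y \<in> F \<and> x * y \<in> F)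
     \<and> (\<forall>c. \<forall>x\<in>F. scaleC c x \<in> F)"

definition selfadjoint_ideal :: "'a::unital_cstar_algebra set \<Rightarrow> bool" where
  "selfadjoint_ideal F \<longleftrightarrow> (\<forall>a. \<forall>b\<in>F. a * b \<in> F \<and> b * a \<in> F) \<and> (\<forall>a\<in>F. star a \<in> F)"

definition directed_set :: "'i set \<Rightarrow> ('i \<Rightarrow> 'i \<Rightarrow> bool) \<Rightarrow> bool" where
  "directed_set I le \<longleftrightarrow> I \<noteq> {} \<and> (\<forall>i\<in>I. le i i)
     \<and> (\<forall>i\<in>I. \<forall>j\<in>I. \<forall>k\<in>I. le i j \<longrightarrow> le j k \<longrightarrow> le i k)
     \<and> (\<forall>i\<in>I. \<forall>j\<in>I. \<exists>k\<in>I. le i k \<and> le j k)"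

definition tails :: "'i set \<Rightarrow> ('i \<Rightarrow> 'i \<Rightarrow> bool) \<Rightarrow> 'i filter" where
  "tails I le = (INF i\<in>I. principal {j\<in>I. le i j})"

text \<open>The net is not required to be increasing.\<close>

definition approximate_unit ::
    "'i set \<Rightarrow> ('i \<Rightarrow> 'i \<Rightarrow> bool) \<Rightarrow> ('i \<Rightarrow> 'a::unital_cstar_algebra) \<Rightarrow> 'a set \<Rightarrow> bool" where
  "approximate_unit I le u F \<longleftrightarrow> directed_set I le \<and> (\<forall>i\<in>I. u i \<in> F)
     \<and> (\<forall>x\<in>F. ((\<lambda>i. x * u i) \<longlongrightarrow> x) (tails I le) \<and> ((\<lambda>i. u i * x) \<longlongrightarrow> x) (tails I le))"

text \<open>HOL cannot quantify over the type of the indices of a net inside a definition, so this type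
  is passed as a parameter. A theorem assuming \<open>finite_type_ideal TYPE('i) F\<close> with \<open>'i\<close> free
  covers approximate units indexed by arbitrary directed sets.\<close>

definition finite_type_ideal :: "'i itself \<Rightarrow> 'a::unital_cstar_algebra set \<Rightarrow> bool" where
  "finite_type_ideal _ F \<longleftrightarrow> subalgebra F \<and> selfadjoint_ideal F
     \<and> (\<exists>(I::'i set) le u. approximate_unit I le u F \<and> (\<forall>i\<in>I. is_projection (u i)))
     \<and> (\<forall>p\<in>F. \<forall>q\<in>F. is_projection p \<longrightarrow> is_projection q \<longrightarrow>
          (\<exists>v. v * star v = q \<and> is_projection (star v * v + p)))"

definition invertible_up_to :: "'a::unital_cstar_algebra \<Rightarrow> 'a \<Rightarrow> 'a \<Rightarrow> bool" where
  "invertible_up_to a p q \<longleftrightarrow>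
     (let a' = (1 - q) * a * (1 - p) in
       \<exists>b. b = (1 - p) * b * (1 - q) \<and> a' * b = 1 - q \<and> b * a' = 1 - p)"

definition upper_semi_Fredholm :: "'a::unital_cstar_algebra set \<Rightarrow> 'a \<Rightarrow> bool" where
  "upper_semi_Fredholm F a \<longleftrightarrow>
     (\<exists>p q. is_projection p \<and> is_projection q \<and> p \<in> F \<and> invertible_up_to a p q)"

definition lower_semi_Fredholm :: "'a::unital_cstar_algebra set \<Rightarrow> 'a \<Rightarrow> bool" where
  "lower_semi_Fredholm F a \<longleftrightarrow>
     (\<exists>p q. is_projection p \<and> is_projection q \<and> q \<in> F \<and> invertible_up_to a p q)"

end

theory Submission
  imports Defs
begin

text \<open>If \<open>b = b (1 - q)\<close> inverts \<open>(1 - q) a (1 - p)\<close>, then \<open>b a (1 - p) = 1 - p\<close>, that is,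
  \<open>1 - b a = (1 - b a) p\<close>. Hence \<open>a x = 0\<close> gives \<open>x = (1 - b a) p x\<close>, which lies in any ideal
  containing \<open>p\<close>. Taking adjoints exchanges \<open>(a, p, q)\<close> with \<open>(a\<^sup>*, q, p)\<close>, so the lower case is
  the upper case for \<open>a\<^sup>*\<close>.\<close>

lemma star_diff: "star (x - y) = star x - star y" for x y :: "'a::unital_cstar_algebra"
  by (rule additive.diff[OF additive.intro[OF star_add]])

lemma star_zero: "star 0 = (0 :: 'a::unital_cstar_algebra)"
  by (rule additive.zero[OF additive.intro[OF star_add]])

lemma star_one: "star 1 = (1 :: 'a::unital_cstar_algebra)"
  by (metis mult_1_right star_mult star_star)

lemma star_compression:
  assumes "is_projection p" "is_projection q"
  shows "star ((1 - q) * a * (1 - p)) = (1 - p) * star a * (1 - q)"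
  using assms by (simp add: is_projection_def star_mult star_diff star_one mult.assoc)

lemma invertible_up_to_star_imp:
  assumes p: "is_projection p" and q: "is_projection q" and inv: "invertible_up_to a p q"
  shows "invertible_up_to (star a) q p"
proof -
  obtain b where b: "b = (1 - p) * b * (1 - q)"
    and right_inverse: "(1 - q) * a * (1 - p) * b = 1 - q"
    and left_inverse: "b * ((1 - q) * a * (1 - p)) = 1 - p"
    using inv unfolding invertible_up_to_def Let_def by blast
  have star_one_minus: "star (1 - p) = 1 - p" "star (1 - q) = 1 - q"
    using p q by (simp_all add: is_projection_def star_diff star_one)
  have "star b = (1 - q) * star b * (1 - p)"
    using b star_compression[OF q p] by metis
  moreover have "(1 - p) * star a * (1 - q) * star b = 1 - p"
    using left_inverse by (metis star_mult star_compression[OF p q] star_one_minus(1))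
  moreover have "star b * ((1 - p) * star a * (1 - q)) = 1 - q"
    using right_inverse by (metis star_mult star_compression[OF p q] star_one_minus(2))
  ultimately show ?thesis
    unfolding invertible_up_to_def Let_def by blast
qed

lemma invertible_up_to_star_iff:
  assumes "is_projection p" "is_projection q"
  shows "invertible_up_to (star a) q p \<longleftrightarrow> invertible_up_to a p q"
  using assms invertible_up_to_star_imp star_star by metis

lemma upper_semi_Fredholm_star_iff:
  "upper_semi_Fredholm F (star a) \<longleftrightarrow> lower_semi_Fredholm F a"
  unfolding upper_semi_Fredholm_def lower_semi_Fredholm_def
  using invertible_up_to_star_iff by blast

lemma invertible_up_to_left_parametrix:
  assumes "invertible_up_to a p q"
  obtains b where "1 - b * a = (1 - b * a) * p"
proof -
  obtain b where "b * ((1 - q) * a * (1 - p)) = 1 - p"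
    using assms unfolding invertible_up_to_def Let_def by blast
  then have "1 - b * (1 - q) * a = (1 - b * (1 - q) * a) * p"
    by (simp add: algebra_simps)
  then show thesis by (rule that)
qed

lemma upper_semi_Fredholm_right_annihilator:
  assumes ideal: "selfadjoint_ideal F" and upper: "upper_semi_Fredholm F a" and "a * x = 0"
  shows "x \<in> F"
proof -
  obtain p q where "p \<in> F" and inv: "invertible_up_to a p q"
    using upper unfolding upper_semi_Fredholm_def by blast
  obtain b where b: "1 - b * a = (1 - b * a) * p"
    using inv by (rule invertible_up_to_left_parametrix)
  have "x = (1 - b * a) * x"
    using \<open>a * x = 0\<close> by (simp add: left_diff_distrib mult.assoc)
  also have "\<dots> = (1 - b * a) * p * x"
    using b by simp
  also have "\<dots> \<in> F"
    using ideal \<open>p \<in> F\<close> unfolding selfadjoint_ideal_def by blast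
  finally show ?thesis .
qed

lemma lower_semi_Fredholm_left_annihilator:
  assumes ideal: "selfadjoint_ideal F" and lower: "lower_semi_Fredholm F a" and "x * a = 0"
  shows "x \<in> F"
proof -
  have "star a * star x = 0"
    using \<open>x * a = 0\<close> by (simp add: star_zero flip: star_mult)
  with lower have "star x \<in> F"
    using upper_semi_Fredholm_right_annihilator[OF ideal] upper_semi_Fredholm_star_iff by blast
  then show ?thesis
    using ideal star_star unfolding selfadjoint_ideal_def by metis
qed

lemma upper_semi_Fredholm_iff_mem:
  assumes ideal: "selfadjoint_ideal F" and p: "is_projection p" and q: "is_projection q"
    and inv: "invertible_up_to a p q" and compressed: "(1 - q) * a * (1 - p) = a"
  shows "upper_semi_Fredholm F a \<longleftrightarrow> p \<in> F"
proof
  have "a * p = (1 - q) * a * ((1 - p) * p)"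
    using compressed by (metis mult.assoc)
  also have "(1 - p) * p = 0"
    using p by (simp add: is_projection_def left_diff_distrib)
  finally have "a * p = 0"
    by simp
  then show "p \<in> F" if "upper_semi_Fredholm F a"
    using upper_semi_Fredholm_right_annihilator[OF ideal that] by blast
  show "upper_semi_Fredholm F a" if "p \<in> F"
    using that p q inv unfolding upper_semi_Fredholm_def by blast
qed

lemma lower_semi_Fredholm_iff_mem:
  assumes ideal: "selfadjoint_ideal F" and p: "is_projection p" and q: "is_projection q"
    and inv: "invertible_up_to a p q" and compressed: "(1 - q) * a * (1 - p) = a"
  shows "lower_semi_Fredholm F a \<longleftrightarrow> q \<in> F"
proof -
  have "(1 - p) * star a * (1 - q) = star a"
    using star_compression[OF p q] compressed by metis
  then have "upper_semi_Fredholm F (star a) \<longleftrightarrow> q \<in> F"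
    using upper_semi_Fredholm_iff_mem[OF ideal q p] inv invertible_up_to_star_iff[OF p q] by blast
  then show ?thesis
    by (simp only: upper_semi_Fredholm_star_iff)
qed

theorem lemma3p9:
  fixes F :: "'a::unital_cstar_algebra set" and a :: 'a
  assumes "finite_type_ideal TYPE('i) F"
  shows "(\<forall>p'. upper_semi_Fredholm F a \<longrightarrow> is_projection p' \<longrightarrow> a * p' = 0 \<longrightarrow> p' \<in> F)
    \<and> (\<forall>p q. is_projection p \<longrightarrow> is_projection q \<longrightarrow> invertible_up_to a p q \<longrightarrow>
          (1 - q) * a * (1 - p) = a \<longrightarrow> (upper_semi_Fredholm F a \<longleftrightarrow> p \<in> F))
    \<and> (\<forall>q'. lower_semi_Fredholm F a \<longrightarrow> is_projection q' \<longrightarrow> q' * a = 0 \<longrightarrow> q' \<in> F)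
    \<and> (\<forall>p q. is_projection p \<longrightarrow> is_projection q \<longrightarrow> invertible_up_to a p q \<longrightarrow>
          (1 - q) * a * (1 - p) = a \<longrightarrow> (lower_semi_Fredholm F a \<longleftrightarrow> q \<in> F))"
proof -
  have ideal: "selfadjoint_ideal F"
    using assms by (simp add: finite_type_ideal_def)
  show ?thesis
    using upper_semi_Fredholm_right_annihilator[OF ideal] upper_semi_Fredholm_iff_mem[OF ideal]
      lower_semi_Fredholm_left_annihilator[OF ideal] lower_semi_Fredholm_iff_mem[OF ideal]
    by blast
qed

end
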